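(* Let $(x_k)_{k=1}^{\infty}$ be a Kritzinger sequence in $[0,1]$. Then there are infinitely many $n \in \mathbb{N}$ such that $$ \max_{0 \leq x \leq 1} \left| \int_0^x \Big( \# \{1 \leq k \leq n: x_k \leq y\} - n y \Big) dy \right| \leq 2 \cdot n^{1/3}.$$
   Context: A Kritzinger sequence is a sequence in $[0,1]$ which starts with an arbitrary finite initial set $x_1,\dots,x_{n_0} \in [0,1]$ and is then extended greedily: for every $n \geq n_0$, given $x_1,\dots,x_n$, the point $x_{n+1}$ is chosen as a global minimizer on $[0,1]$ of $F(x) = (n+1)x^2 - x - 2\sum_{k=1}^n \max\{x_k,x\}$. *)

theory Defs
  imports "HOL-Analysis.Analysis"
begin

(* Sequences are indexed from 1; the value x 0 is never used. *)

definition kritzinger_functional :: "(nat \<Rightarrow> real) \<Rightarrow> nat \<Rightarrow> real \<Rightarrow> real" where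
  "kritzinger_functional x n t = real (n + 1) * t\<^sup>2 - t - 2 * (\<Sum>k=1..n. max (x k) t)"

(* Any global minimizer on [0,1] may be chosen at each step.  Allowing n0 = 0 adds no
   sequences: if n0 is a witness, then so is every larger number. *)
definition kritzinger_sequence :: "(nat \<Rightarrow> real) \<Rightarrow> bool" where
  "kritzinger_sequence x \<longleftrightarrow>
    (\<exists>n0. (\<forall>k\<in>{1..n0}. x k \<in> {0..1}) \<and>
          (\<forall>n\<ge>n0. is_arg_min (kritzinger_functional x n) (\<lambda>t. t \<in> {0..1}) (x (Suc n))))"

definition discrepancy_integral :: "(nat \<Rightarrow> real) \<Rightarrow> nat \<Rightarrow> real \<Rightarrow> real" where
  "discrepancy_integral x n t =
    integral {0..t} (\<lambda>y. real (card {k\<in>{1..n}. x k \<le> y}) - real n * y)"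

(* The maximum over [0,1] is written as a supremum, since Max is only meaningful for finite
   sets.  The two lemmas below show that the integrand is integrable and that the supremum is
   attained, so neither the integral nor the supremum takes a default value. *)
definition max_discrepancy_integral :: "(nat \<Rightarrow> real) \<Rightarrow> nat \<Rightarrow> real" where
  "max_discrepancy_integral x n = (SUP t\<in>{0..1}. \<bar>discrepancy_integral x n t\<bar>)"

lemma discrepancy_integrable:
  "(\<lambda>y. real (card {k\<in>{1..n}. x k \<le> y}) - real n * y) integrable_on {a..b::real}"
proof -
  have "mono_on {a..b} (\<lambda>y. real (card {k\<in>{1..n}. x k \<le> y}))"
    by (intro mono_onI of_nat_mono card_mono) auto
  then have "(\<lambda>y. real (card {k\<in>{1..n}. x k \<le> y})) integrable_on {a..b}"
    by (rule integrable_on_mono_on)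
  moreover have "(\<lambda>y. real n * y) integrable_on {a..b}"
    by (intro integrable_continuous_interval continuous_intros)
  ultimately show ?thesis
    by (rule integrable_diff)
qed

lemma max_discrepancy_integral_attained:
  shows "\<exists>t\<in>{0..1}. max_discrepancy_integral x n = \<bar>discrepancy_integral x n t\<bar>"
    and "t \<in> {0..1} \<Longrightarrow> \<bar>discrepancy_integral x n t\<bar> \<le> max_discrepancy_integral x n"
proof -
  have "continuous_on {0..1} (\<lambda>t. \<bar>discrepancy_integral x n t\<bar>)"
    unfolding discrepancy_integral_def
    by (intro continuous_intros indefinite_integral_continuous_1 discrepancy_integrable)
  then obtain s where s: "s \<in> {0..1}"
      "\<And>t. t \<in> {0..1} \<Longrightarrow> \<bar>discrepancy_integral x n t\<bar> \<le> \<bar>discrepancy_integral x n s\<bar>"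
    using continuous_attains_sup[of "{0..1::real}"] by (metis atLeastAtMost_iff compact_Icc
        empty_iff order_refl zero_le_one)
  have "max_discrepancy_integral x n = \<bar>discrepancy_integral x n s\<bar>"
    unfolding max_discrepancy_integral_def using s by (intro cSup_eq_maximum) auto
  with s show "\<exists>t\<in>{0..1}. max_discrepancy_integral x n = \<bar>discrepancy_integral x n t\<bar>"
    and "t \<in> {0..1} \<Longrightarrow> \<bar>discrepancy_integral x n t\<bar> \<le> max_discrepancy_integral x n"
    by auto
qed

end

theory Submission
  imports Defs
begin

text \<open>
  Write \<open>F\<close> for the functional at stage \<open>n\<close>, \<open>z\<close> for its minimizer \<open>x (Suc n)\<close> and \<open>E n\<close> for the
  squared \<open>L\<^sup>2\<close> discrepancy of the first \<open>n\<close> points. Then \<open>E (n+1) = E n + F z - \<integral>F + 1/6\<close>,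
  and since \<open>E\<close> is nonnegative, \<open>\<integral>F - F z \<le> 1/2\<close> for infinitely many \<open>n\<close>. For such \<open>n\<close>,
  the nonnegative function \<open>F - F z\<close> has small integral, while \<open>F\<close> is \<open>(n+1) t\<^sup>2\<close> minus a convex
  function. Hence a large value of \<open>F - F z\<close> at a point persists on an interval of length of order
  \<open>n powr (-1/3)\<close> on one side of it, which bounds \<open>F - F z\<close> by a multiple of \<open>n powr (1/3)\<close>.
  Finally \<open>F 0 - F t\<close> is twice the discrepancy integral up to the bounded term \<open>t - t\<^sup>2\<close>.
\<close>

section \<open>Integrals of truncated and polynomial functions\<close>

lemma has_integral_step:
  fixes f :: "real \<Rightarrow> real"
  assumes "(f has_integral I) {a..t}" "0 \<le> a"
  shows "((\<lambda>y. of_bool (a \<le> y) * f y) has_integral I) {0..t}"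
proof -
  have "((\<lambda>y. if y \<in> {a..t} then f y else 0) has_integral I) {0..t}"
    using assms by (subst has_integral_restrict) auto
  then show ?thesis
    by (rule has_integral_eq[rotated]) auto
qed

lemma has_integral_linear_interval:
  fixes c d a b :: real
  assumes "a \<le> b"
  shows "((\<lambda>y. c + d * y) has_integral (c * (b - a) + d * (b\<^sup>2 - a\<^sup>2) / 2)) {a..b}"
  using has_integral_add[OF has_integral_const_real[of c a b]
      has_integral_mult_right[OF ident_has_integral[OF assms], of d]] assms
  by (simp add: algebra_simps diff_divide_distrib)

lemma has_integral_square_unit: "((\<lambda>y::real. y\<^sup>2) has_integral 1/3) {0..1}"
proof -
  have "((\<lambda>y::real. y\<^sup>2) has_integral (1 ^ 3 / 3 - 0 ^ 3 / 3)) {0..1}"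
    by (rule fundamental_theorem_of_calculus)
      (auto intro!: derivative_eq_intros simp flip: has_real_derivative_iff_has_vector_derivative)
  then show ?thesis by simp
qed

section \<open>Squared L2 discrepancy as an energy of pairs of points\<close>

definition local_discrepancy :: "real \<Rightarrow> real \<Rightarrow> real" where
  "local_discrepancy a y = of_bool (a \<le> y) - y"

text \<open>Closed form of the L2 inner product on [0,1] of the local discrepancies of two
  points.\<close>

definition discrepancy_kernel :: "real \<Rightarrow> real \<Rightarrow> real" where
  "discrepancy_kernel a b = 1/3 - max a b + (a\<^sup>2 + b\<^sup>2) / 2"

lemma has_integral_discrepancy_kernel:
  assumes "a \<in> {0..1}" "b \<in> {0..1}"
  shows "((\<lambda>y. local_discrepancy a y * local_discrepancy b y) has_integral discrepancy_kernel a b) {0..1}"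
proof -
  have const: "((\<lambda>y. of_bool (c \<le> y) * 1) has_integral (1 - c)) {0..1}" if "c \<in> {0..1}" for c :: real
    using that has_integral_linear_interval[of c 1 1 0] by (intro has_integral_step) auto
  have lin: "((\<lambda>y. of_bool (c \<le> y) * y) has_integral ((1 - c\<^sup>2) / 2)) {0..1}" if "c \<in> {0..1}" for c :: real
    using that has_integral_linear_interval[of c 1 0 1] by (intro has_integral_step) auto
  \<comment> \<open>The product of the steps at \<open>a\<close> and \<open>b\<close> is the step at
    \<open>max a b\<close>; this is the source of the maximum in the kernel.\<close>
  have "((\<lambda>y. of_bool (max a b \<le> y) * 1 - of_bool (a \<le> y) * y - of_bool (b \<le> y) * y + y\<^sup>2)
      has_integral (1 - max a b - (1 - a\<^sup>2) / 2 - (1 - b\<^sup>2) / 2 + 1/3)) {0..1}"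
    using assms
    by (intro has_integral_add has_integral_diff const lin has_integral_square_unit) auto
  moreover have "1 - max a b - (1 - a\<^sup>2) / 2 - (1 - b\<^sup>2) / 2 + 1/3 = discrepancy_kernel a b"
    by (simp add: discrepancy_kernel_def field_simps)
  moreover have "of_bool (max a b \<le> y) * 1 - of_bool (a \<le> y) * y - of_bool (b \<le> y) * y + y\<^sup>2 =
      local_discrepancy a y * local_discrepancy b y" for y
    by (simp add: local_discrepancy_def algebra_simps power2_eq_square of_bool_conj)
  ultimately show ?thesis by simp
qed

definition energy :: "(nat \<Rightarrow> real) \<Rightarrow> nat \<Rightarrow> real" where
  "energy x n = (\<Sum>j=1..n. \<Sum>k=1..n. discrepancy_kernel (x j) (x k))"

text \<open>Expanding a square shows that the double sum is the integral of the squared total local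
  discrepancy.\<close>

lemma energy_nonneg:
  assumes "\<And>k. k \<in> {1..n} \<Longrightarrow> x k \<in> {0..1}"
  shows "0 \<le> energy x n"
proof -
  have "((\<lambda>y. (\<Sum>k=1..n. local_discrepancy (x k) y)\<^sup>2) has_integral energy x n) {0..1}"
    unfolding energy_def power2_eq_square sum_product
    by (intro has_integral_sum finite_atLeastAtMost has_integral_discrepancy_kernel assms)
  then show ?thesis
    by (rule has_integral_nonneg) simp
qed

lemma energy_Suc:
  "energy x (Suc n) = energy x n + 2 * (\<Sum>k=1..n. discrepancy_kernel (x k) (x (Suc n)))
     + discrepancy_kernel (x (Suc n)) (x (Suc n))"
proof -
  have "discrepancy_kernel a b = discrepancy_kernel b a" for a b
    by (simp add: discrepancy_kernel_def max.commute add.commute)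
  then show ?thesis
    by (simp add: energy_def sum.distrib)
qed

section \<open>The greedy functional, its mean and the discrepancy integral\<close>

lemma has_integral_max:
  assumes "a \<in> {0..1}"
  shows "((\<lambda>t. max a t) has_integral ((1 + a\<^sup>2) / 2)) {0..1::real}"
proof -
  have "((\<lambda>t. of_bool (a \<le> t) * (- a + 1 * t)) has_integral ((-a) * (1 - a) + 1 * (1\<^sup>2 - a\<^sup>2) / 2)) {0..1}"
    using assms by (intro has_integral_step has_integral_linear_interval) auto
  from has_integral_add[OF has_integral_const_real[of a 0 1] this]
  have "((\<lambda>t. a + of_bool (a \<le> t) * (- a + 1 * t)) has_integral ((1 + a\<^sup>2) / 2)) {0..1}"
    by (simp add: field_simps power2_eq_square)
  then show ?thesis
    by (rule has_integral_eq[rotated]) auto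
qed

lemma has_integral_kritzinger_functional:
  assumes "\<And>k. k \<in> {1..n} \<Longrightarrow> x k \<in> {0..1}"
  shows "(kritzinger_functional x n has_integral
           (real (n + 1) / 3 - 1/2 - real n - (\<Sum>k=1..n. (x k)\<^sup>2))) {0..1}"
proof -
  have "((\<lambda>t. real (n + 1) * t\<^sup>2 - t - 2 * (\<Sum>k=1..n. max (x k) t)) has_integral
      (real (n + 1) * (1/3) - 1/2 - 2 * (\<Sum>k=1..n. (1 + (x k)\<^sup>2) / 2))) {0..1}"
    using has_integral_linear_interval[of 0 1 0 1]
    by (intro has_integral_diff has_integral_mult_right has_integral_square_unit has_integral_sum
        has_integral_max assms finite_atLeastAtMost) auto
  moreover have "2 * (\<Sum>k=1..n. (1 + (x k)\<^sup>2) / 2) = real n + (\<Sum>k=1..n. (x k)\<^sup>2)"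
    by (simp add: sum.distrib flip: sum_divide_distrib)
  ultimately show ?thesis
    by (simp add: kritzinger_functional_def[abs_def] algebra_simps)
qed

text \<open>In the energy increment, the terms containing the new point add up to exactly the
  functional there. The remaining 2n/3 + 1/3 plus the sum of the squared old points is 1/6 minus the
  integral of the functional.\<close>

lemma energy_Suc_kritzinger:
  assumes "\<And>k. k \<in> {1..n} \<Longrightarrow> x k \<in> {0..1}"
  shows "energy x (Suc n) = energy x n + kritzinger_functional x n (x (Suc n))
           - integral {0..1} (kritzinger_functional x n) + 1/6"
proof -
  let ?z = "x (Suc n)"
  have "2 * (\<Sum>k=1..n. discrepancy_kernel (x k) ?z) =
      (\<Sum>k=1..n. (2/3 + ?z\<^sup>2) - 2 * max (x k) ?z + (x k)\<^sup>2)"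
    unfolding sum_distrib_left discrepancy_kernel_def by (intro sum.cong) (auto simp: field_simps)
  also have "\<dots> = real n * (2/3 + ?z\<^sup>2) - 2 * (\<Sum>k=1..n. max (x k) ?z) + (\<Sum>k=1..n. (x k)\<^sup>2)"
    by (simp add: sum.distrib sum_subtractf sum_distrib_left)
  finally have "2 * (\<Sum>k=1..n. discrepancy_kernel (x k) ?z) = \<dots>" .
  moreover have "discrepancy_kernel ?z ?z = 1/3 - ?z + ?z\<^sup>2"
    by (simp add: discrepancy_kernel_def)
  moreover have "integral {0..1} (kritzinger_functional x n) =
      real (n + 1) / 3 - 1/2 - real n - (\<Sum>k=1..n. (x k)\<^sup>2)"
    by (intro integral_unique has_integral_kritzinger_functional assms)
  moreover have "kritzinger_functional x n ?z =
      real n * ?z\<^sup>2 + ?z\<^sup>2 - ?z - 2 * (\<Sum>k=1..n. max (x k) ?z)"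
    by (simp add: kritzinger_functional_def algebra_simps)
  ultimately show ?thesis
    unfolding energy_Suc by (simp add: distrib_left add_divide_distrib)
qed

text \<open>A point \<open>a\<close> contributes \<open>max a t - a\<close> to the integrated
  counting function. The correction \<open>t\<^sup>2 - t\<close> arises because the functional has
  \<open>(n + 1) * t\<^sup>2 - t\<close> in place of \<open>n * t\<^sup>2\<close>.\<close>

lemma discrepancy_integral_eq:
  assumes "\<And>k. k \<in> {1..n} \<Longrightarrow> 0 \<le> x k" "0 \<le> t"
  shows "discrepancy_integral x n t =
    (kritzinger_functional x n 0 - kritzinger_functional x n t + t\<^sup>2 - t) / 2"
proof -
  \<comment> \<open>For \<open>t < a\<close> the interval \<open>{a..t}\<close> is empty and the
    value is 0, so the maximum covers both cases.\<close>
  have step: "((\<lambda>y. of_bool (a \<le> y) * 1) has_integral (max a t - a)) {0..t}" if "0 \<le> a" for a :: real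
    using that has_integral_linear_interval[of a t 1 0]
    by (intro has_integral_step) (auto simp: max_def)
  have card: "real (card {k\<in>{1..n}. x k \<le> y}) = (\<Sum>k=1..n. of_bool (x k \<le> y) * 1)" for y
    by (simp add: Int_def)
  have "((\<lambda>y. (\<Sum>k=1..n. of_bool (x k \<le> y) * 1) - real n * y) has_integral
      ((\<Sum>k=1..n. max (x k) t - x k) - real n * (t\<^sup>2 / 2))) {0..t}"
    using assms has_integral_linear_interval[of 0 t 0 1]
    by (intro has_integral_diff has_integral_sum step has_integral_mult_right) auto
  then have "discrepancy_integral x n t = (\<Sum>k=1..n. max (x k) t - x k) - real n * (t\<^sup>2 / 2)"
    unfolding discrepancy_integral_def card by (rule integral_unique)
  moreover have "(\<Sum>k=1..n. max (x k) 0) = (\<Sum>k=1..n. x k)"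
    using assms by (intro sum.cong) auto
  ultimately show ?thesis
    by (simp add: kritzinger_functional_def sum_subtractf field_simps)
qed

section \<open>Pointwise bounds for semiconcave functions with small integral\<close>

lemma semiconcave_lower_bound:
  fixes F :: "real \<Rightarrow> real"
  assumes "convex_on S (\<lambda>t. N * t\<^sup>2 - F t)" "0 \<le> N" "p \<in> S" "q \<in> S"
    and "0 \<le> F p" "0 \<le> F q" "0 \<le> s" "s \<le> 1/2"
  shows "F p / 2 - N * (q - p)\<^sup>2 / 4 \<le> F ((1 - s) * p + s * q)"
proof -
  let ?u = "(1 - s) * p + s * q"
  have "N * ?u\<^sup>2 - F ?u \<le> (1 - s) * (N * p\<^sup>2 - F p) + s * (N * q\<^sup>2 - F q)"
    using convex_onD[OF assms(1), of s p q] assms by simp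
  \<comment> \<open>The gap between chord and parabola is all that \<open>F\<close> can lose against
    its own chord.\<close>
  moreover have "(1 - s) * (N * p\<^sup>2) + s * (N * q\<^sup>2) - N * ?u\<^sup>2 = N * (q - p)\<^sup>2 * (s * (1 - s))"
    by (simp add: power2_eq_square algebra_simps)
  ultimately have "(1 - s) * F p + s * F q - N * (q - p)\<^sup>2 * (s * (1 - s)) \<le> F ?u"
    by (simp add: algebra_simps)
  moreover have "N * (q - p)\<^sup>2 * (s * (1 - s)) \<le> N * (q - p)\<^sup>2 * (1/4)"
  proof (rule mult_left_mono)
    show "s * (1 - s) \<le> 1/4"
      using zero_le_power2[of "s - 1/2"] by (simp add: power2_eq_square algebra_simps)
  qed (use assms in simp)
  moreover have "F p / 2 \<le> (1 - s) * F p"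
    using assms mult_right_mono[of "1/2" "1 - s" "F p"] by simp
  moreover have "0 \<le> s * F q"
    using assms by simp
  ultimately show ?thesis by linarith
qed

lemma semiconcave_bound:
  fixes F :: "real \<Rightarrow> real"
  assumes conv: "convex_on {0..1} (\<lambda>t. N * t\<^sup>2 - F t)" and N: "8 \<le> N"
    and int: "(F has_integral I) {0..1}" "I \<le> 1/2"
    and nonneg: "\<And>t. t \<in> {0..1} \<Longrightarrow> 0 \<le> F t"
    and p: "p \<in> {0..1}"
  shows "F p \<le> 5/2 * N powr (1/3)"
proof -
  define R where "R = N powr (1/3)"
  \<comment> \<open>This length balances the two errors: the parabola costs
    \<open>N * r\<^sup>2 = R\<close>, and averaging over length \<open>r\<close> costs a factor
    \<open>1 / r = R\<close>.\<close>
  define r where "r = 1 / R"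
  have "8 powr (1/3) \<le> R"
    unfolding R_def using N by (intro powr_mono2) auto
  moreover have "(8::real) powr (1/3) = 2"
    using powr_powr[of 2 3 "1/3"] by simp
  ultimately have R: "2 \<le> R" by simp
  have "R ^ 3 = N"
    using N by (simp add: R_def powr_powr flip: powr_numeral)
  then have Nr: "N * r\<^sup>2 = R"
    using R by (simp add: r_def power2_eq_square power3_eq_cube field_simps)
  have r: "0 < r" "r \<le> 1/2"
    using R by (auto simp: r_def field_simps)
  \<comment> \<open>Going from \<open>p\<close> towards the farther endpoint, a step of length
    \<open>r \<le> 1/2\<close> stays in [0,1]. Its first half consists of the convex combinations
    with weight \<open>s \<le> 1/2\<close>.\<close>
  have "\<exists>l. {l..l + r/2} \<subseteq> {0..1} \<and> (\<forall>u\<in>{l..l + r/2}. F p / 2 - R / 4 \<le> F u)"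
  proof (cases "p \<le> 1/2")
    case True
    have "F p / 2 - R / 4 \<le> F u" if "u \<in> {p..p + r/2}" for u
      using semiconcave_lower_bound[OF conv, of p "p + r" "(u - p) / r"] that True p r N Nr nonneg
      by (simp add: field_simps)
    then show ?thesis using True p r by (intro exI[of _ p]) auto
  next
    case False
    have "F p / 2 - R / 4 \<le> F u" if "u \<in> {p - r/2..p - r/2 + r/2}" for u
      using semiconcave_lower_bound[OF conv, of p "p - r" "(p - u) / r"] that False p r N Nr nonneg
      by (simp add: field_simps)
    then show ?thesis using False p r by (intro exI[of _ "p - r/2"]) auto
  qed
  then obtain l where l: "{l..l + r/2} \<subseteq> {0..1}" "\<And>u. u \<in> {l..l + r/2} \<Longrightarrow> F p / 2 - R / 4 \<le> F u"
    by blast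
  have F: "F integrable_on {0..1}" "F integrable_on {l..l + r/2}"
    using int(1) integrable_on_subinterval[OF _ l(1)] by blast+
  \<comment> \<open>Comparing integrals yields \<open>F p / 2 - R / 4 \<le> R\<close>, hence the
    constant 5/2.\<close>
  have "(F p / 2 - R / 4) * (r / 2) = integral {l..l + r/2} (\<lambda>u. F p / 2 - R / 4)"
    using r by simp
  also have "\<dots> \<le> integral {l..l + r/2} F"
    using F l(2) by (intro integral_le) auto
  also have "\<dots> \<le> integral {0..1} F"
    using F l(1) nonneg by (intro integral_subset_le) auto
  also have "\<dots> \<le> 1/2"
    using int by (simp add: integral_unique)
  finally show ?thesis
    using R by (simp add: r_def R_def[symmetric] field_simps)
qed

lemma convex_on_max_const:
  fixes a :: real
  assumes "convex S"
  shows "convex_on S (\<lambda>t. max a t)"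
proof (rule convex_onI)
  fix s u v :: real
  assume s: "0 < s" "s < 1"
  have "(1 - s) * a + s * a \<le> (1 - s) * max a u + s * max a v"
    and "(1 - s) * u + s * v \<le> (1 - s) * max a u + s * max a v"
    using s by (intro add_mono mult_left_mono; simp)+
  then show "max a ((1 - s) *\<^sub>R u + s *\<^sub>R v) \<le> (1 - s) * max a u + s * max a v"
    by (simp add: left_diff_distrib)
qed (rule assms)

lemma convex_on_sum_max:
  fixes x :: "'a \<Rightarrow> real"
  assumes "convex S" "finite A"
  shows "convex_on S (\<lambda>t. \<Sum>k\<in>A. max (x k) t)"
  using assms(2)
  by (induction A) (auto intro!: convex_on_add convex_on_max_const assms(1) convex_on_const[THEN iffD2])

section \<open>From a small integral to the discrepancy bound, infinitely often\<close>

lemma discrepancy_bound: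
  assumes x: "\<And>k. k \<in> {1..n} \<Longrightarrow> x k \<in> {0..1}" and n: "7 \<le> n"
    and arg_min: "is_arg_min (kritzinger_functional x n) (\<lambda>t. t \<in> {0..1}) z"
    and small: "integral {0..1} (kritzinger_functional x n) - kritzinger_functional x n z \<le> 1/2"
  shows "max_discrepancy_integral x n \<le> 2 * real n powr (1/3)"
proof -
  let ?F = "kritzinger_functional x n"
  have z: "z \<in> {0..1}" "\<And>t. t \<in> {0..1} \<Longrightarrow> ?F z \<le> ?F t"
    using arg_min by (auto simp: is_arg_min_linorder)
  have bound: "?F t - ?F z \<le> 5/2 * real (n + 1) powr (1/3)" if "t \<in> {0..1}" for t
  proof (rule semiconcave_bound[OF _ _ _ _ _ that])
    show "convex_on {0..1} (\<lambda>t. real (n + 1) * t\<^sup>2 - (?F t - ?F z))"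
    proof -
      have "convex_on {0..1} (\<lambda>t. (t + 2 * (\<Sum>k=1..n. max (x k) t)) + ?F z)"
        by (intro convex_on_add convex_on_cmul convex_on_sum_max
            convex_on_ident[THEN iffD2] convex_on_const[THEN iffD2]) auto
      then show ?thesis
        by (simp add: kritzinger_functional_def[of x n t for t] algebra_simps)
    qed
    have "?F integrable_on {0..1}"
      using has_integral_kritzinger_functional[of n x] x by blast
    then show "((\<lambda>t. ?F t - ?F z) has_integral (integral {0..1} ?F - ?F z)) {0..1}"
      using has_integral_diff[OF integrable_integral has_integral_const_real[of "?F z" 0 1]] by simp
  qed (use n small z in auto)
  \<comment> \<open>For \<open>n \<ge> 7\<close>, passing from \<open>n + 1\<close> to
    \<open>n\<close> costs at most the factor 8/7.\<close>
  have "real (n + 1) powr (1/3) \<le> (8/7 * real n) powr (1/3)"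
    using n by (intro powr_mono2) auto
  also have "\<dots> = (8/7) powr (1/3) * real n powr (1/3)"
    by (rule powr_mult)
  also have "\<dots> \<le> (8/7) powr 1 * real n powr (1/3)"
    by (intro mult_right_mono powr_mono) auto
  finally have n1: "real (n + 1) powr (1/3) \<le> 8/7 * real n powr (1/3)"
    by simp
  have n2: "1 \<le> real n powr (1/3)"
    using n by (intro ge_one_powr_ge_zero) auto
  obtain t where t: "t \<in> {0..1}" "max_discrepancy_integral x n = \<bar>discrepancy_integral x n t\<bar>"
    using max_discrepancy_integral_attained(1) by blast
  have "0 \<le> t - t\<^sup>2" "t - t\<^sup>2 \<le> 1/4"
    using t(1) mult_left_le[of t t] zero_le_power2[of "t - 1/2"]
    by (auto simp: power2_eq_square algebra_simps)
  moreover have "discrepancy_integral x n t = (?F 0 - ?F t + t\<^sup>2 - t) / 2"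
    using x t(1) by (intro discrepancy_integral_eq) auto
  \<comment> \<open>Both \<open>?F 0\<close> and \<open>?F t\<close> lie above \<open>?F z\<close>
    by at most 5/2 * 8/7 cube roots of \<open>n\<close>, and so do they differ. Adding 1/4 for
    \<open>t - t\<^sup>2\<close> and halving gives 87/56 < 2.\<close>
  ultimately show ?thesis
    using bound[OF t(1)] bound[of 0] z(2)[OF t(1)] z(2)[of 0] n1 n2 t(2) by auto
qed

theorem theorem2:
  fixes x :: "nat \<Rightarrow> real"
  assumes "kritzinger_sequence x"
  shows "infinite {n::nat. max_discrepancy_integral x n \<le> 2 * real n powr (1 / 3)}"
proof
  assume "finite {n::nat. max_discrepancy_integral x n \<le> 2 * real n powr (1 / 3)}"
  then obtain m where m: "\<And>n. max_discrepancy_integral x n \<le> 2 * real n powr (1 / 3) \<Longrightarrow> n \<le> m"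
    unfolding finite_nat_set_iff_bounded_le by auto
  obtain n0 where init: "\<And>k. k \<in> {1..n0} \<Longrightarrow> x k \<in> {0..1}"
    and greedy: "\<And>n. n0 \<le> n \<Longrightarrow> is_arg_min (kritzinger_functional x n) (\<lambda>t. t \<in> {0..1}) (x (Suc n))"
    using assms unfolding kritzinger_sequence_def by blast
  have x: "x k \<in> {0..1}" if "1 \<le> k" for k
  proof (cases "k \<le> n0")
    case False
    then obtain n where "k = Suc n" "n0 \<le> n" by (cases k) auto
    with greedy show ?thesis by (auto simp: is_arg_min_def)
  qed (use that init in auto)
  \<comment> \<open>From \<open>M\<close> on the choice is greedy, the discrepancy lemma applies,
    and its conclusion fails.\<close>
  define M where "M = max (max n0 7) (Suc m)"
  \<comment> \<open>The smallness hypothesis must then fail, so the energy changes by less than 1/6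
    - 1/2 = -1/3.\<close>
  have decrease: "energy x (Suc n) \<le> energy x n - 1/3" if "M \<le> n" for n
  proof -
    have "\<not> integral {0..1} (kritzinger_functional x n) - kritzinger_functional x n (x (Suc n)) \<le> 1/2"
      using discrepancy_bound[of n x "x (Suc n)"] x greedy[of n] m[of n] that by (auto simp: M_def)
    with energy_Suc_kritzinger[of n x] x show ?thesis by auto
  qed
  have energy: "energy x (M + j) \<le> energy x M - real j / 3" for j
  proof (induction j)
    case (Suc j)
    with decrease[of "M + j"] show ?case by (simp add: add_divide_distrib)
  qed simp
  \<comment> \<open>After this many steps the energy would be negative.\<close>
  obtain j where "3 * energy x M < real j"
    using reals_Archimedean2 by blast
  with energy[of j] energy_nonneg[of "M + j" x] x show False by auto
qed

end
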